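(* Let $p\in[1,\infty]$ and let $E=\{E_a\}$ and $F=\{F_b\}$ be measurements acting on $\mathbb{C}^d$. If $\widetilde E$ is a measurement obtained from $E$ by post-processing, then $\Upsilon_p(\widetilde E,F)\le\Upsilon_p(E,F)$. More generally, if $\widetilde E$ and $\widetilde F$ are obtained by post-processing from $E$ and $F$, respectively, then $\Upsilon_p(\widetilde E,\widetilde F)\le\Upsilon_p(E,F)$.
   Context: A measurement with $n$ outcomes acting on $\mathbb{C}^d$ is a family $\{E_a\}_{a=1}^n$ of non-zero positive semi-definite operators on $\mathbb{C}^d$ with $\sum_a E_a=\mathbb{1}$. A measurement $\widetilde E=\{\widetilde E_{a'}\}_{a'}$ is a post-processing of $E=\{E_a\}_a$ if there are real numbers $P_{a'|a}\ge 0$ with $\sum_{a'}P_{a'|a}=1$ for every $a$ such that $\widetilde E_{a'}=\sum_a P_{a'|a}E_a$ for every $a'$ (the number of outcomes may change). The Schatten $p$-norm $\|A\|_p$ is the $\ell_p$-norm of the vector of singular values of $A$ (the largest singular value for $p=\infty$). Define $\Upsilon_p(E,F):=\sum_{a,b}\|[E_a,F_b]\|_p$, where $[A,B]=AB-BA$. *)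

theory Defs
  imports
    "HOL-Analysis.Analysis"
    "HOL-Computational_Algebra.Polynomial"
    "Jordan_Normal_Form.Schur_Decomposition"
begin

text \<open>Operators on the $d$-dimensional complex space are the matrices in
  \<open>carrier_mat d d\<close>; outcomes of a measurement with \<open>n\<close> outcomes are \<open>1, \<dots>, n\<close>, and the values
  of a family outside this range are irrelevant.\<close>

text \<open>The order on \<^typ>\<open>complex\<close> is the one of \<^theory>\<open>HOL-Library.Complex_Order\<close>: \<open>0 \<le> z\<close> says
  that \<open>z\<close> is real and non-negative. Hence the condition below forces \<open>A\<close> to be Hermitian.\<close>

definition psd :: "nat \<Rightarrow> complex mat \<Rightarrow> bool" where
  "psd d A \<longleftrightarrow> A \<in> carrier_mat d d \<and> (\<forall>v \<in> carrier_vec d. 0 \<le> (A *\<^sub>v v) \<bullet>c v)"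

definition mat_sum :: "nat \<Rightarrow> (nat \<Rightarrow> complex mat) \<Rightarrow> nat set \<Rightarrow> complex mat" where
  "mat_sum d = finsum (module_mat TYPE(complex) d d)"

definition measurement :: "nat \<Rightarrow> nat \<Rightarrow> (nat \<Rightarrow> complex mat) \<Rightarrow> bool" where
  "measurement d n E \<longleftrightarrow>
     (\<forall>a \<in> {1..n}. psd d (E a) \<and> E a \<noteq> 0\<^sub>m d d) \<and> mat_sum d E {1..n} = 1\<^sub>m d"

text \<open>\<open>post_processing d n E n' E'\<close>: the family \<open>E'\<close> with \<open>n'\<close> outcomes arises from the family \<open>E\<close>
  with \<open>n\<close> outcomes; \<open>P a' a\<close> is the conditional probability $P_{a'|a}$.\<close>

definition post_processing ::
    "nat \<Rightarrow> nat \<Rightarrow> (nat \<Rightarrow> complex mat) \<Rightarrow> nat \<Rightarrow> (nat \<Rightarrow> complex mat) \<Rightarrow> bool" where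
  "post_processing d n E n' E' \<longleftrightarrow>
     (\<exists>P :: nat \<Rightarrow> nat \<Rightarrow> real.
        (\<forall>a' \<in> {1..n'}. \<forall>a \<in> {1..n}. 0 \<le> P a' a) \<and>
        (\<forall>a \<in> {1..n}. (\<Sum>a' = 1..n'. P a' a) = 1) \<and>
        (\<forall>a' \<in> {1..n'}. E' a' = mat_sum d (\<lambda>a. complex_of_real (P a' a) \<cdot>\<^sub>m E a) {1..n}))"

text \<open>The singular values of \<open>A\<close>, with multiplicity: square roots of the eigenvalues of $A^* A$
  (which are real and non-negative), repeated according to algebraic multiplicity.\<close>

definition singular_values :: "complex mat \<Rightarrow> real multiset" where
  "singular_values A = image_mset (\<lambda>z. sqrt (Re z)) (proots (char_poly (mat_adjoint A * A)))"

definition schatten_norm :: "ereal \<Rightarrow> complex mat \<Rightarrow> real" where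
  "schatten_norm p A =
     (if p = \<infinity> then Max (set_mset (singular_values A))
      else (\<Sum>s \<in># singular_values A. s powr real_of_ereal p) powr (1 / real_of_ereal p))"

definition commutator :: "complex mat \<Rightarrow> complex mat \<Rightarrow> complex mat" where
  "commutator A B = A * B - B * A"

definition Upsilon ::
    "ereal \<Rightarrow> nat \<Rightarrow> (nat \<Rightarrow> complex mat) \<Rightarrow> nat \<Rightarrow> (nat \<Rightarrow> complex mat) \<Rightarrow> real" where
  "Upsilon p n E m F = (\<Sum>a = 1..n. \<Sum>b = 1..m. schatten_norm p (commutator (E a) (F b)))"

end

theory Submission
  imports Defs
begin

text \<open>Commutators of Hermitian matrices are skew-Hermitian, so post-processing the first argument
  replaces the commutators by non-negative combinations of skew-Hermitian matrices, and the claim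
  follows from the triangle inequality for the Schatten norm. Since only normal matrices occur, the
  triangle inequality needs no singular value decomposition: for normal \<open>A\<close> and unitary \<open>V\<close> the
  \<open>\<ell>\<^sub>p\<close>-norm of the diagonal of \<open>V\<^sup>* A V\<close> is at most the Schatten norm of \<open>A\<close>, with equality in an
  eigenbasis; choosing \<open>V\<close> as an eigenbasis of \<open>A + B\<close> reduces to Minkowski's inequality. The second
  argument is treated through the symmetry of \<open>Upsilon\<close>.\<close>

section \<open>Finite \<open>\<ell>\<^sub>p\<close>-norms\<close>

text \<open>The endpoint 0 needs its own argument: for \<open>x = 0\<close> the claim reduces to
  \<open>t powr q \<le> t\<close> with \<open>0 < t < 1\<close>.\<close>

lemma convex_on_powr_nonneg:
  fixes q :: real
  assumes "1 \<le> q"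
  shows "convex_on {0..} (\<lambda>x. x powr q)"
proof (rule convex_on_linorderI)
  fix t x y :: real
  assume t: "0 < t" "t < 1" and xy: "x \<in> {0..}" "y \<in> {0..}" "x < y"
  show "((1 - t) *\<^sub>R x + t *\<^sub>R y) powr q \<le> (1 - t) * x powr q + t * y powr q"
  proof (cases "x = 0")
    case True
    have "t powr q \<le> t powr 1"
      using t assms by (intro powr_mono') auto
    then show ?thesis
      using True t xy by (simp add: powr_mult mult_right_mono)
  next
    case False
    then show ?thesis
      using convex_onD[OF powr_convex[OF assms], of t x y] t xy by auto
  qed
qed simp

text \<open>No absolute values are taken: this is a norm on non-negative families only.\<close>

definition lp_norm :: "ereal \<Rightarrow> 'i set \<Rightarrow> ('i \<Rightarrow> real) \<Rightarrow> real" where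
  "lp_norm p I x =
     (if p = \<infinity> then Max (x ` I)
      else (\<Sum>i\<in>I. x i powr real_of_ereal p) powr (1 / real_of_ereal p))"

lemma lp_norm_cong: "(\<And>i. i \<in> I \<Longrightarrow> x i = y i) \<Longrightarrow> lp_norm p I x = lp_norm p I y"
  by (simp add: lp_norm_def cong: image_cong)

lemma one_le_ereal_cases:
  fixes p :: ereal
  assumes "1 \<le> p"
  obtains "p = \<infinity>" | q where "p = ereal q" "1 \<le> q"
  using assms by (cases p) auto

lemma lp_norm_nonneg:
  assumes "finite I" "I \<noteq> {}" "\<And>i. i \<in> I \<Longrightarrow> 0 \<le> x i"
  shows "0 \<le> lp_norm p I x"
  using assms by (auto simp: lp_norm_def Max_ge_iff)

lemma lp_norm_mono:
  assumes p: "1 \<le> p" and "finite I" "I \<noteq> {}"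
    and "\<And>i. i \<in> I \<Longrightarrow> 0 \<le> x i" "\<And>i. i \<in> I \<Longrightarrow> x i \<le> y i"
  shows "lp_norm p I x \<le> lp_norm p I y"
  using p
proof (cases rule: one_le_ereal_cases)
  case 1
  have "x i \<le> Max (y ` I)" if "i \<in> I" for i
    using assms that by (auto intro: order_trans[OF _ Max_ge])
  then show ?thesis
    using 1 assms by (auto simp: lp_norm_def)
next
  case (2 q)
  then show ?thesis
    using assms by (auto simp: lp_norm_def intro!: powr_mono2 sum_mono sum_nonneg)
qed

lemma lp_norm_scale:
  assumes p: "1 \<le> p" and I: "finite I" "I \<noteq> {}"
    and x: "\<And>i. i \<in> I \<Longrightarrow> 0 \<le> x i" and c: "0 \<le> c"
  shows "lp_norm p I (\<lambda>i. c * x i) = c * lp_norm p I x"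
  using p
proof (cases rule: one_le_ereal_cases)
  case 1
  have "mono ((*) c)"
    using c by (auto intro: monoI mult_left_mono)
  then show ?thesis
    using 1 I mono_Max_commute[of "(*) c" "x ` I"] by (simp add: lp_norm_def image_image)
next
  case (2 q)
  then show ?thesis
    using c x
    by (simp add: lp_norm_def powr_mult sum_nonneg powr_powr flip: sum_distrib_left)
qed

lemma lp_norm_eq_0_imp:
  assumes "1 \<le> q" "finite I" "\<And>i. i \<in> I \<Longrightarrow> 0 \<le> x i" "lp_norm (ereal q) I x = 0" "i \<in> I"
  shows "x i = 0"
  using assms sum_nonneg_eq_0_iff[of I "\<lambda>i. x i powr q"] by (simp add: lp_norm_def)

text \<open>For finite exponents this is convexity of the \<open>q\<close>-th power applied to the normalised
  summands, whose \<open>q\<close>-th powers sum to \<open>1\<close>.\<close>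

lemma lp_norm_triangle:
  assumes p: "1 \<le> p" and I: "finite I" "I \<noteq> {}"
    and x: "\<And>i. i \<in> I \<Longrightarrow> 0 \<le> x i" and y: "\<And>i. i \<in> I \<Longrightarrow> 0 \<le> y i"
  shows "lp_norm p I (\<lambda>i. x i + y i) \<le> lp_norm p I x + lp_norm p I y"
  using p
proof (cases rule: one_le_ereal_cases)
  case 1
  then show ?thesis
    using I by (auto simp: lp_norm_def intro!: add_mono)
next
  case (2 q)
  let ?X = "lp_norm p I x" and ?Y = "lp_norm p I y"
  have nn: "0 \<le> ?X" "0 \<le> ?Y"
    using I x y by (auto intro: lp_norm_nonneg)
  have Xq: "(\<Sum>i\<in>I. x i powr q) = ?X powr q" and Yq: "(\<Sum>i\<in>I. y i powr q) = ?Y powr q"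
    using 2 by (auto simp: lp_norm_def powr_powr sum_nonneg)
  \<comment> \<open>A zero norm cannot be divided by, but it forces its family to vanish, and then
    both sides agree.\<close>
  consider "?X = 0" | "?Y = 0" | "0 < ?X" "0 < ?Y"
    using nn by linarith
  then show ?thesis
  proof cases
    case A: 1
    then have "x i = 0" if "i \<in> I" for i
      using lp_norm_eq_0_imp[of q I x] that 2 I x by auto
    then show ?thesis
      using A by (simp add: lp_norm_def cong: image_cong)
  next
    case A: 2
    then have "y i = 0" if "i \<in> I" for i
      using lp_norm_eq_0_imp[of q I y] that 2 I y by auto
    then show ?thesis
      using A by (simp add: lp_norm_def cong: image_cong)
  next
    case pos: 3
    \<comment> \<open>With these weights \<open>(x i + y i) / ?s\<close> is a convex combination of
      the normalised entries \<open>x i / ?X\<close> and \<open>y i / ?Y\<close>.\<close>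
    let ?s = "?X + ?Y" let ?t = "?Y / ?s"
    have t: "0 \<le> ?t" "?t \<le> 1" "1 - ?t = ?X / ?s"
      using pos by (auto simp: field_simps)
    have "((x i + y i) / ?s) powr q \<le> (1 - ?t) * (x i / ?X) powr q + ?t * (y i / ?Y) powr q"
      if "i \<in> I" for i
    proof -
      have "(x i + y i) / ?s = (1 - ?t) * (x i / ?X) + ?t * (y i / ?Y)"
        unfolding t(3) using pos by (simp add: add_divide_distrib)
      then show ?thesis
        using convex_onD[OF convex_on_powr_nonneg[OF 2(2)], of ?t "x i / ?X" "y i / ?Y"]
          t(1,2) x[OF that] y[OF that] pos by simp
    qed
    then have "(\<Sum>i\<in>I. ((x i + y i) / ?s) powr q)
        \<le> (\<Sum>i\<in>I. (1 - ?t) * (x i / ?X) powr q + ?t * (y i / ?Y) powr q)"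
      by (rule sum_mono)
    also have "\<dots> = (1 - ?t) * ((\<Sum>i\<in>I. x i powr q) / ?X powr q)
        + ?t * ((\<Sum>i\<in>I. y i powr q) / ?Y powr q)"
      using x y pos
      by (simp add: sum.distrib powr_divide sum_divide_distrib sum_distrib_left)
    also have "\<dots> = 1"
      using pos by (simp add: Xq Yq)
    finally have "(\<Sum>i\<in>I. (x i + y i) powr q) / ?s powr q \<le> 1"
      using x y pos by (simp add: powr_divide sum_divide_distrib)
    then have "(\<Sum>i\<in>I. (x i + y i) powr q) \<le> ?s powr q"
      using pos by (simp add: field_simps)
    then have "(\<Sum>i\<in>I. (x i + y i) powr q) powr (1 / q) \<le> (?s powr q) powr (1 / q)"
      using 2 by (intro powr_mono2) (auto intro: sum_nonneg)
    then show ?thesis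
      using 2 pos by (simp add: lp_norm_def powr_powr)
  qed
qed

text \<open>For finite exponents the row sums permit Jensen's inequality in each row, and the column
  sums evaluate the total after the sums are interchanged. For the maximum, each new entry is an
  average of the old ones.\<close>

lemma lp_norm_doubly_stochastic:
  assumes p: "1 \<le> p" and I: "finite I" "I \<noteq> {}"
    and x: "\<And>i. i \<in> I \<Longrightarrow> 0 \<le> x i" and w: "\<And>i j. i \<in> I \<Longrightarrow> j \<in> I \<Longrightarrow> 0 \<le> w i j"
    and row: "\<And>i. i \<in> I \<Longrightarrow> (\<Sum>j\<in>I. w i j) = 1"
    and col: "\<And>j. j \<in> I \<Longrightarrow> (\<Sum>i\<in>I. w i j) = 1"
  shows "lp_norm p I (\<lambda>i. \<Sum>j\<in>I. w i j * x j) \<le> lp_norm p I x"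
  using p
proof (cases rule: one_le_ereal_cases)
  case 1
  have "(\<Sum>j\<in>I. w i j * x j) \<le> Max (x ` I)" if "i \<in> I" for i
  proof -
    have "(\<Sum>j\<in>I. w i j * x j) \<le> (\<Sum>j\<in>I. w i j * Max (x ` I))"
      using I w that by (intro sum_mono mult_left_mono) auto
    also have "\<dots> = Max (x ` I)"
      using row[OF that] by (simp flip: sum_distrib_right)
    finally show ?thesis .
  qed
  then show ?thesis
    using 1 I by (auto simp: lp_norm_def)
next
  case (2 q)
  have "(\<Sum>i\<in>I. (\<Sum>j\<in>I. w i j * x j) powr q) \<le> (\<Sum>i\<in>I. \<Sum>j\<in>I. w i j * x j powr q)"
  proof (rule sum_mono)
    fix i assume "i \<in> I"
    then show "(\<Sum>j\<in>I. w i j * x j) powr q \<le> (\<Sum>j\<in>I. w i j * x j powr q)"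
      using convex_on_sum[OF I convex_on_powr_nonneg[OF 2(2)] row, of i x] w x by simp
  qed
  also have "\<dots> = (\<Sum>j\<in>I. (\<Sum>i\<in>I. w i j) * x j powr q)"
    by (subst sum.swap) (simp add: sum_distrib_right)
  also have "\<dots> = (\<Sum>j\<in>I. x j powr q)"
    using col by simp
  finally show ?thesis
    using 2 by (auto simp: lp_norm_def intro!: powr_mono2 sum_nonneg)
qed

section \<open>Unitary diagonalization of normal matrices\<close>

lemma dim_mat_adjoint [simp]:
  "dim_row (mat_adjoint A) = dim_col A" "dim_col (mat_adjoint A) = dim_row A"
  by (simp_all add: mat_adjoint_def)

lemma mat_adjoint_carrier [simp]:
  "A \<in> carrier_mat n m \<Longrightarrow> mat_adjoint A \<in> carrier_mat m n"
  by (intro carrier_matI) auto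

lemma index_mat_adjoint [simp]:
  "i < dim_col A \<Longrightarrow> j < dim_row A \<Longrightarrow> mat_adjoint A $$ (i, j) = conjugate (A $$ (j, i))"
  by (simp add: mat_adjoint_def mat_of_rows_def)

lemma mat_adjoint_mat_adjoint [simp]: "mat_adjoint (mat_adjoint A) = A"
  by (rule eq_matI) simp_all

lemma mat_adjoint_one [simp]: "mat_adjoint (1\<^sub>m n :: complex mat) = 1\<^sub>m n"
  by (rule eq_matI) simp_all

lemma mat_adjoint_mult:
  fixes A :: "complex mat"
  assumes "A \<in> carrier_mat n k" "B \<in> carrier_mat k m"
  shows "mat_adjoint (A * B) = mat_adjoint B * mat_adjoint A"
  by (rule eq_matI) (use assms in \<open>auto simp: scalar_prod_def mult.commute intro!: sum.cong\<close>)

lemma index_mat_mult_sum: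
  assumes "A \<in> carrier_mat n k" "B \<in> carrier_mat k m" "i < n" "j < m"
  shows "(A * B) $$ (i, j) = (\<Sum>l<k. A $$ (i, l) * B $$ (l, j))"
  using assms by (simp add: scalar_prod_def atLeast0LessThan)

definition unitary_mat :: "nat \<Rightarrow> complex mat \<Rightarrow> bool" where
  "unitary_mat n U \<longleftrightarrow>
     U \<in> carrier_mat n n \<and> mat_adjoint U * U = 1\<^sub>m n \<and> U * mat_adjoint U = 1\<^sub>m n"

lemma unitary_matI:
  assumes "U \<in> carrier_mat n n" "mat_adjoint U * U = 1\<^sub>m n"
  shows "unitary_mat n U"
  using assms mat_mult_left_right_inverse[of "mat_adjoint U" n U] by (simp add: unitary_mat_def)

lemma unitary_mat_adjoint: "unitary_mat n U \<Longrightarrow> unitary_mat n (mat_adjoint U)"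
  by (auto simp: unitary_mat_def)

lemma mult_cancel_middle:
  fixes A :: "'a :: comm_ring_1 mat"
  assumes "A \<in> carrier_mat n n" "P \<in> carrier_mat n n" "Q \<in> carrier_mat n n"
    "B \<in> carrier_mat n n" "P * Q = 1\<^sub>m n"
  shows "A * P * (Q * B) = A * B"
proof -
  have "A * P * (Q * B) = A * (P * Q * B)"
    using assms(1-4) by (simp add: assoc_mult_mat[of _ n n _ n _ n] mult_carrier_mat[of _ n n _ n])
  then show ?thesis
    using assms by simp
qed

lemma unitary_mat_mult:
  assumes "unitary_mat n U" "unitary_mat n V"
  shows "unitary_mat n (U * V)"
proof (rule unitary_matI)
  show "U * V \<in> carrier_mat n n"
    using assms by (auto simp: unitary_mat_def)
  have "mat_adjoint (U * V) * (U * V) = mat_adjoint V * mat_adjoint U * (U * V)"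
    using assms by (subst mat_adjoint_mult[of U n n V n]) (auto simp: unitary_mat_def)
  also have "\<dots> = mat_adjoint V * V"
    using assms by (intro mult_cancel_middle[of _ n]) (auto simp: unitary_mat_def)
  finally show "mat_adjoint (U * V) * (U * V) = 1\<^sub>m n"
    using assms by (simp add: unitary_mat_def)
qed

text \<open>The inner factor \<open>U * mat_adjoint U\<close> cancels. Together with
  \<open>mat_adjoint_conj\<close> this shows that unitary conjugation preserves normality.\<close>

lemma mult_conj_conj:
  fixes A B U :: "complex mat"
  assumes U: "unitary_mat n U" and A: "A \<in> carrier_mat n n" and B: "B \<in> carrier_mat n n"
  shows "(mat_adjoint U * A * U) * (mat_adjoint U * B * U) = mat_adjoint U * (A * B) * U"
proof -
  have U': "U \<in> carrier_mat n n" "mat_adjoint U \<in> carrier_mat n n" "U * mat_adjoint U = 1\<^sub>m n"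
    using U by (auto simp: unitary_mat_def)
  have "mat_adjoint U * A * U * (mat_adjoint U * B * U)
      = (mat_adjoint U * A) * U * (mat_adjoint U * (B * U))"
    using U' B by (simp add: mult_carrier_mat[of _ n n _ n] assoc_mult_mat[of _ n n _ n _ n])
  also have "\<dots> = (mat_adjoint U * A) * (B * U)"
    using U' A B by (intro mult_cancel_middle[of _ n]) auto
  finally show ?thesis
    using U' A B by (simp add: mult_carrier_mat[of _ n n _ n] assoc_mult_mat[of _ n n _ n _ n])
qed

lemma mat_adjoint_conj:
  fixes A U :: "complex mat"
  assumes "U \<in> carrier_mat n n" "A \<in> carrier_mat n n"
  shows "mat_adjoint (mat_adjoint U * A * U) = mat_adjoint U * mat_adjoint A * U"
  using assms
  by (simp add: mat_adjoint_mult[of _ n n _ n] assoc_mult_mat[of _ n n _ n _ n])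

text \<open>Complete \<open>v\<close> to a basis, apply Gram-Schmidt, which keeps the first vector
  \<open>v\<close>, and normalise the results to obtain the columns. The factor \<open>c\<close> may
  stay unspecified, since every multiple of an eigenvector satisfies the same eigenvalue
  equation.\<close>

lemma unitary_mat_first_col:
  fixes v :: "complex vec"
  assumes v: "v \<in> carrier_vec n" and v0: "v \<noteq> 0\<^sub>v n"
  obtains U c where "unitary_mat n U" "col U 0 = c \<cdot>\<^sub>v v"
proof -
  have n: "n \<noteq> 0"
    using v v0 by auto
  interpret cof_vec_space n "TYPE(complex)" .
  define b where "b = basis_completion v"
  define ws where "ws = gram_schmidt n b"
  from basis_completion[OF v v0, folded b_def]
  have span_b: "span (set b) = carrier_vec n" and dist_b: "distinct b"
    and indep: "\<not> lin_dep (set b)" and b: "set b \<subseteq> carrier_vec n" and hdb: "hd b = v"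
    and len_b: "length b = n" by auto
  from hdb len_b n obtain vs where bv: "b = v # vs" by (cases b) auto
  from gram_schmidt_result[OF b dist_b indep refl, folded ws_def]
  have ws: "set ws \<subseteq> carrier_vec n" "corthogonal ws" "length ws = n"
    by (auto simp: len_b)
  from gram_schmidt_hd[OF v, of vs, folded bv] have "hd ws = v"
    unfolding ws_def .
  then have ws0: "ws ! 0 = v"
    using ws n by (simp add: hd_conv_nth[symmetric] flip: length_greater_0_conv)
  have wsc: "ws ! i \<in> carrier_vec n" if "i < n" for i
    using ws that by auto
  \<comment> \<open>The lengths of the orthogonal vectors; the inner product of a vector with itself
    is real and non-negative, so taking \<open>Re\<close> loses nothing.\<close>
  define r where "r i = sqrt (Re (ws ! i \<bullet>c ws ! i))" for i
  have r: "complex_of_real (r i) * complex_of_real (r i) = ws ! i \<bullet>c ws ! i" "r i \<noteq> 0" if "i < n" for i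
  proof -
    have "0 \<le> ws ! i \<bullet>c ws ! i"
      by (rule conjugate_square_ge_0_vec)
    moreover have "ws ! i \<bullet>c ws ! i \<noteq> 0"
      using corthogonalD[OF ws(2), of i i] that ws by auto
    ultimately have "0 < Re (ws ! i \<bullet>c ws ! i)" "Im (ws ! i \<bullet>c ws ! i) = 0"
      by (auto simp: less_eq_complex_def complex_eq_iff)
    then show "complex_of_real (r i) * complex_of_real (r i) = ws ! i \<bullet>c ws ! i" "r i \<noteq> 0"
      by (auto simp: r_def complex_eq_iff simp flip: of_real_mult)
  qed
  define U where "U = Matrix.mat n n (\<lambda>(i, j). ws ! j $ i / complex_of_real (r j))"
  have "mat_adjoint U * U = 1\<^sub>m n"
  proof (rule eq_matI)
    fix i j assume "i < dim_row (1\<^sub>m n :: complex mat)" "j < dim_col (1\<^sub>m n :: complex mat)"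
    then have ij: "i < n" "j < n" by auto
    have "(mat_adjoint U * U) $$ (i, j)
        = (\<Sum>k<n. cnj (ws ! i $ k) / r i * (ws ! j $ k / r j))"
      using ij by (subst index_mat_mult_sum[of _ n n _ n]) (auto simp: U_def)
    also have "\<dots> = (ws ! j \<bullet>c ws ! i) / (r i * r j)"
      using ij wsc[of i] wsc[of j]
      by (auto simp: scalar_prod_def atLeast0LessThan sum_divide_distrib mult.commute intro!: sum.cong)
    also have "\<dots> = (if i = j then 1 else 0)"
      using corthogonalD[OF ws(2), of j i] ij ws(3) r[of i] by auto
    finally show "(mat_adjoint U * U) $$ (i, j) = 1\<^sub>m n $$ (i, j)"
      using ij by simp
  qed (auto simp: U_def)
  then have "unitary_mat n U"
    by (intro unitary_matI) (auto simp: U_def)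
  moreover have "col U 0 = (1 / r 0) \<cdot>\<^sub>v v"
    using n v ws0 by (intro eq_vecI) (auto simp: U_def)
  ultimately show ?thesis
    using that by blast
qed

text \<open>Over the complex numbers the characteristic polynomial splits into \<open>n\<close>
  linear factors, so for \<open>n \<noteq> 0\<close> it has a root.\<close>

lemma complex_mat_eigenvector:
  fixes A :: "complex mat"
  assumes A: "A \<in> carrier_mat n n" and n: "n \<noteq> 0"
  obtains e v where "v \<in> carrier_vec n" "v \<noteq> 0\<^sub>v n" "A *\<^sub>v v = e \<cdot>\<^sub>v v"
proof -
  obtain as where as: "char_poly A = (\<Prod>a\<leftarrow>as. [:- a, 1:])" "length as = n"
    using char_poly_factorized[OF A] by auto
  then obtain e where "e \<in> set as"
    using n by (cases as) auto
  then have "poly (char_poly A) e = 0"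
    unfolding as(1) by (auto simp: poly_prod_list prod_list_zero_iff)
  then have "eigenvalue A e"
    using eigenvalue_root_char_poly[OF A] by simp
  then show ?thesis
    using that A unfolding eigenvalue_def eigenvector_def by auto
qed

section \<open>Block diagonal matrices with a leading scalar block\<close>

lemma one_block_mult:
  fixes V W :: "complex mat"
  assumes "V \<in> carrier_mat n n" "W \<in> carrier_mat n n"
  shows "four_block_mat (Matrix.mat 1 1 (\<lambda>_. x)) (0\<^sub>m 1 n) (0\<^sub>m n 1) V *
      four_block_mat (Matrix.mat 1 1 (\<lambda>_. y)) (0\<^sub>m 1 n) (0\<^sub>m n 1) W =
    four_block_mat (Matrix.mat 1 1 (\<lambda>_. x * y)) (0\<^sub>m 1 n) (0\<^sub>m n 1) (V * W)"
proof -
  have "Matrix.mat 1 1 (\<lambda>_. x) * Matrix.mat 1 1 (\<lambda>_. y) = Matrix.mat 1 1 (\<lambda>_. x * y)"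
    by (rule eq_matI) (auto simp: scalar_prod_def)
  then show ?thesis
    using assms by (subst mult_four_block_mat[of _ 1 1 _ n _ n _ _ 1 _ n]) auto
qed

lemma one_block_adjoint:
  fixes V :: "complex mat"
  assumes "V \<in> carrier_mat n n"
  shows "mat_adjoint (four_block_mat (Matrix.mat 1 1 (\<lambda>_. x)) (0\<^sub>m 1 n) (0\<^sub>m n 1) V) =
    four_block_mat (Matrix.mat 1 1 (\<lambda>_. cnj x)) (0\<^sub>m 1 n) (0\<^sub>m n 1) (mat_adjoint V)"
  by (rule eq_matI) (use assms in auto)

lemma one_block_unitary:
  assumes "unitary_mat n V"
  shows "unitary_mat (Suc n) (four_block_mat (Matrix.mat 1 1 (\<lambda>_. 1)) (0\<^sub>m 1 n) (0\<^sub>m n 1) V)"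
proof (rule unitary_matI)
  have V: "V \<in> carrier_mat n n" "mat_adjoint V \<in> carrier_mat n n"
    using assms by (auto simp: unitary_mat_def)
  then show "four_block_mat (Matrix.mat 1 1 (\<lambda>_. 1)) (0\<^sub>m 1 n) (0\<^sub>m n 1) V \<in> carrier_mat (Suc n) (Suc n)"
    by auto
  have "four_block_mat (Matrix.mat 1 1 (\<lambda>_. 1)) (0\<^sub>m 1 n) (0\<^sub>m n 1) (1\<^sub>m n) = (1\<^sub>m (Suc n) :: complex mat)"
    by (rule eq_matI) auto
  then show "mat_adjoint (four_block_mat (Matrix.mat 1 1 (\<lambda>_. 1)) (0\<^sub>m 1 n) (0\<^sub>m n 1) V) *
      four_block_mat (Matrix.mat 1 1 (\<lambda>_. 1)) (0\<^sub>m 1 n) (0\<^sub>m n 1) V = 1\<^sub>m (Suc n)"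
    using assms V by (simp only: one_block_adjoint one_block_mult) (simp add: unitary_mat_def)
qed

text \<open>Conjugating by a unitary whose first column is an eigenvector makes the first column of
  the matrix a multiple of the first unit vector. Comparing the \<open>(0, 0)\<close> entries of \<open>A\<^sup>* A\<close> and
  \<open>A A\<^sup>*\<close> shows that then the first row vanishes off the diagonal as well, and one recurses.\<close>

theorem normal_mat_unitarily_diagonalizable:
  fixes A :: "complex mat"
  assumes "A \<in> carrier_mat n n" "mat_adjoint A * A = A * mat_adjoint A"
  obtains U D where "unitary_mat n U" "D \<in> carrier_mat n n" "diagonal_mat D"
    "A = U * D * mat_adjoint U"
proof -
  have "\<exists>U D. unitary_mat n U \<and> D \<in> carrier_mat n n \<and> diagonal_mat D \<and> A = U * D * mat_adjoint U"
    using assms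
  proof (induction n arbitrary: A)
    case 0
    have "A = 1\<^sub>m 0 * A * mat_adjoint (1\<^sub>m 0)"
      by (rule eq_matI) (use 0 in auto)
    then show ?case
      using 0 by (intro exI[of _ "1\<^sub>m 0"] exI[of _ A]) (simp add: unitary_mat_def diagonal_mat_def)
  next
    case (Suc n)
    note A = Suc.prems(1)
    obtain e v where v: "v \<in> carrier_vec (Suc n)" "v \<noteq> 0\<^sub>v (Suc n)" "A *\<^sub>v v = e \<cdot>\<^sub>v v"
      using complex_mat_eigenvector[OF A] by blast
    obtain U c where U: "unitary_mat (Suc n) U" and col: "col U 0 = c \<cdot>\<^sub>v v"
      using unitary_mat_first_col[OF v(1,2)] .
    have Uc: "U \<in> carrier_mat (Suc n) (Suc n)" "mat_adjoint U \<in> carrier_mat (Suc n) (Suc n)"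
      and UU: "mat_adjoint U * U = 1\<^sub>m (Suc n)" "U * mat_adjoint U = 1\<^sub>m (Suc n)"
      using U by (auto simp: unitary_mat_def)
    define B where "B = mat_adjoint U * A * U"
    have B: "B \<in> carrier_mat (Suc n) (Suc n)"
      using A Uc by (auto simp: B_def)
    have normal: "mat_adjoint B * B = B * mat_adjoint B"
      using A Suc.prems(2) by (simp add: B_def mat_adjoint_conj[OF Uc(1)] mult_conj_conj[OF U])
    have AU: "col (A * U) 0 = e \<cdot>\<^sub>v col U 0"
    proof -
      have "col (A * U) 0 = A *\<^sub>v col U 0"
        using A Uc by (intro col_mult2[of _ "Suc n" "Suc n" _ "Suc n"]) auto
      then show ?thesis
        using A v col by (simp add: mult_mat_vec[of A "Suc n" "Suc n"] smult_smult_assoc mult.commute)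
    qed
    \<comment> \<open>The first column of \<open>A * U\<close> is \<open>e\<close> times that of
      \<open>U\<close>, and \<open>mat_adjoint U\<close> sends the latter to the first unit
      vector.\<close>
    have col0: "B $$ (i, 0) = (if i = 0 then e else 0)" if i: "i < Suc n" for i
    proof -
      have "B $$ (i, 0) = (mat_adjoint U * (A * U)) $$ (i, 0)"
        using A Uc by (simp add: B_def assoc_mult_mat[of _ "Suc n" "Suc n" _ "Suc n" _ "Suc n"]
            mult_carrier_mat[of _ "Suc n" "Suc n" _ "Suc n"])
      also have "\<dots> = row (mat_adjoint U) i \<bullet> (e \<cdot>\<^sub>v col U 0)"
        using A Uc i AU by simp
      also have "\<dots> = e * (mat_adjoint U * U) $$ (i, 0)"
        using Uc i by simp
      finally show ?thesis
        using i by (simp add: UU)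
    qed
    have row0: "B $$ (0, Suc j) = 0" if "j < n" for j
    proof -
      have "(mat_adjoint B * B) $$ (0, 0) = cnj e * e"
        using B col0
        by (subst index_mat_mult_sum[of _ "Suc n" "Suc n" _ "Suc n"])
          (auto simp: sum.lessThan_Suc_shift simp del: sum.lessThan_Suc)
      moreover have "(B * mat_adjoint B) $$ (0, 0)
          = e * cnj e + (\<Sum>k<n. complex_of_real ((cmod (B $$ (0, Suc k)))\<^sup>2))"
        using B col0
        by (subst index_mat_mult_sum[of _ "Suc n" "Suc n" _ "Suc n"])
          (auto simp: sum.lessThan_Suc_shift complex_norm_square simp del: sum.lessThan_Suc of_real_power)
      ultimately have "(\<Sum>k<n. complex_of_real ((cmod (B $$ (0, Suc k)))\<^sup>2)) = 0"
        using normal by (simp add: mult.commute del: of_real_power)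
      then have "(\<Sum>k<n. (cmod (B $$ (0, Suc k)))\<^sup>2) = 0"
        by (simp del: of_real_power flip: of_real_sum)
      then show ?thesis
        using that by (subst (asm) sum_nonneg_eq_0_iff) auto
    qed
    define C where "C = Matrix.mat n n (\<lambda>(i, j). B $$ (Suc i, Suc j))"
    have C: "C \<in> carrier_mat n n"
      by (simp add: C_def)
    have BC: "B = four_block_mat (Matrix.mat 1 1 (\<lambda>_. e)) (0\<^sub>m 1 n) (0\<^sub>m n 1) C"
    proof (rule eq_matI)
      fix i j
      assume "i < dim_row (four_block_mat (Matrix.mat 1 1 (\<lambda>_. e)) (0\<^sub>m 1 n) (0\<^sub>m n 1) C)"
        "j < dim_col (four_block_mat (Matrix.mat 1 1 (\<lambda>_. e)) (0\<^sub>m 1 n) (0\<^sub>m n 1) C)"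
      then show "B $$ (i, j) = four_block_mat (Matrix.mat 1 1 (\<lambda>_. e)) (0\<^sub>m 1 n) (0\<^sub>m n 1) C $$ (i, j)"
        using col0 row0 by (cases i; cases j) (auto simp: C_def)
    qed (use B C in auto)
    have "mat_adjoint C * C = C * mat_adjoint C"
    proof (rule eq_matI)
      fix i j assume "i < dim_row (C * mat_adjoint C)" "j < dim_col (C * mat_adjoint C)"
      then have ij: "i < n" "j < n"
        using C by auto
      \<comment> \<open>The product for \<open>B\<close> has one more summand, at index 0; it
        contains entries of the first row of \<open>B\<close> off the diagonal, which vanish. In the
        product in the other order below, the first column plays this part.\<close>
      have "(mat_adjoint C * C) $$ (i, j) = (mat_adjoint B * B) $$ (Suc i, Suc j)"
        using B C ij row0
        by (simp add: index_mat_mult_sum[of _ "Suc n" "Suc n" _ "Suc n"]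
            index_mat_mult_sum[of _ n n _ n] sum.lessThan_Suc_shift C_def
            del: index_mult_mat sum.lessThan_Suc)
      also have "\<dots> = (B * mat_adjoint B) $$ (Suc i, Suc j)"
        by (simp only: normal)
      also have "\<dots> = (C * mat_adjoint C) $$ (i, j)"
        using B C ij col0
        by (simp add: index_mat_mult_sum[of _ "Suc n" "Suc n" _ "Suc n"]
            index_mat_mult_sum[of _ n n _ n] sum.lessThan_Suc_shift C_def
            del: index_mult_mat sum.lessThan_Suc)
      finally show "(mat_adjoint C * C) $$ (i, j) = (C * mat_adjoint C) $$ (i, j)" .
    qed (use C in auto)
    from Suc.IH[OF C this] obtain V D where V: "unitary_mat n V"
      and D: "D \<in> carrier_mat n n" "diagonal_mat D" and CVD: "C = V * D * mat_adjoint V"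
      by blast
    have Vc: "V \<in> carrier_mat n n" "mat_adjoint V \<in> carrier_mat n n"
      using V by (auto simp: unitary_mat_def)
    \<comment> \<open>The diagonalization of the smaller block is extended by the first unit vector,
      with eigenvalue \<open>e\<close>.\<close>
    define V' where "V' = four_block_mat (Matrix.mat 1 1 (\<lambda>_. 1)) (0\<^sub>m 1 n) (0\<^sub>m n 1) V"
    define D' where "D' = four_block_mat (Matrix.mat 1 1 (\<lambda>_. e)) (0\<^sub>m 1 n) (0\<^sub>m n 1) D"
    have V': "unitary_mat (Suc n) V'"
      unfolding V'_def using V by (rule one_block_unitary)
    then have V'c: "V' \<in> carrier_mat (Suc n) (Suc n)" "mat_adjoint V' \<in> carrier_mat (Suc n) (Suc n)"
      by (auto simp: unitary_mat_def)
    have D'c: "D' \<in> carrier_mat (Suc n) (Suc n)"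
      using D by (auto simp: D'_def)
    have D'd: "diagonal_mat D'"
      using D by (auto simp: D'_def diagonal_mat_def)
    have "B = V' * D' * mat_adjoint V'"
      using Vc D by (simp add: BC CVD V'_def D'_def one_block_adjoint one_block_mult[of _ n]
          mult_carrier_mat[of _ n n _ n] del: One_nat_def)
    moreover have "A = U * B * mat_adjoint U"
    proof -
      have "U * B * mat_adjoint U = (U * mat_adjoint U) * A * (U * mat_adjoint U)"
        using A Uc by (simp add: B_def assoc_mult_mat[of _ "Suc n" "Suc n" _ "Suc n" _ "Suc n"]
            mult_carrier_mat[of _ "Suc n" "Suc n" _ "Suc n"])
      then show ?thesis
        using A by (simp add: UU)
    qed
    ultimately have "A = (U * V') * D' * mat_adjoint (U * V')"
      using Uc V'c D'c
      by (simp add: mat_adjoint_mult[of _ "Suc n" "Suc n" _ "Suc n"]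
          assoc_mult_mat[of _ "Suc n" "Suc n" _ "Suc n" _ "Suc n"]
            mult_carrier_mat[of _ "Suc n" "Suc n" _ "Suc n"])
    then show ?case
      using unitary_mat_mult[OF U V'] D'c D'd by blast
  qed
  then show ?thesis
    using that by blast
qed

section \<open>Schatten norms of normal matrices\<close>

lemma proots_prod_list_linear:
  fixes as :: "'a :: idom list"
  shows "proots (\<Prod>a\<leftarrow>as. [:- a, 1:]) = mset as"
proof (induction as)
  case (Cons a as)
  have "(\<Prod>a\<leftarrow>as. [:- a, 1:]) \<noteq> 0"
    by (auto simp: prod_list_zero_iff)
  then show ?case
    using Cons by (simp add: proots_mult del: mult_pCons_left)
qed simp

lemma unitary_mat_cancel:
  assumes "unitary_mat n U" "A \<in> carrier_mat n n"
  shows "mat_adjoint U * (U * A * mat_adjoint U) * U = A"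
proof -
  have U: "U \<in> carrier_mat n n" "mat_adjoint U \<in> carrier_mat n n" "mat_adjoint U * U = 1\<^sub>m n"
    using assms by (auto simp: unitary_mat_def)
  have "mat_adjoint U * (U * A * mat_adjoint U) * U
      = (mat_adjoint U * U) * A * (mat_adjoint U * U)"
    using U(1,2) assms(2)
    by (simp add: assoc_mult_mat[of _ n n _ n _ n] mult_carrier_mat[of _ n n _ n])
  then show ?thesis
    using assms(2) by (simp add: U(3))
qed

text \<open>With \<open>A\<close> the matrix in question, \<open>mat_adjoint A * A\<close> is
  similar to the diagonal matrix \<open>mat_adjoint D * D\<close>, so both have the same
  characteristic polynomial. Thus the singular values of a normal matrix are the moduli of its
  eigenvalues.\<close>

lemma singular_values_unitary_diagonal:
  assumes U: "unitary_mat n U" and D: "D \<in> carrier_mat n n" "diagonal_mat D"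
  shows "singular_values (U * D * mat_adjoint U)
    = image_mset (\<lambda>i. cmod (D $$ (i, i))) (mset_set {..<n})"
proof -
  let ?A = "U * D * mat_adjoint U" and ?M = "mat_adjoint D * D"
  have Uc: "U \<in> carrier_mat n n" "mat_adjoint U \<in> carrier_mat n n"
    "U * mat_adjoint U = 1\<^sub>m n" "mat_adjoint U * U = 1\<^sub>m n"
    using U by (auto simp: unitary_mat_def)
  have M: "?M \<in> carrier_mat n n"
    using D by (auto intro: mult_carrier_mat)
  have entry: "?M $$ (i, j) = (if i = j then complex_of_real ((cmod (D $$ (i, i)))\<^sup>2) else 0)"
    if "i < n" "j < n" for i j
  proof -
    have "?M $$ (i, j) = (\<Sum>k<n. cnj (D $$ (k, i)) * D $$ (k, j))"
      using D that by (simp add: index_mat_mult_sum[of _ n n _ n] del: index_mult_mat)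
    also have "\<dots> = (\<Sum>k<n. if k = i then cnj (D $$ (i, i)) * D $$ (i, j) else 0)"
      using D that by (intro sum.cong) (auto simp: diagonal_mat_def)
    also have "\<dots> = cnj (D $$ (i, i)) * D $$ (i, j)"
      using that by simp
    finally show ?thesis
      using D that
      by (auto simp: diagonal_mat_def complex_norm_square mult.commute simp del: of_real_power)
  qed
  have "mat_adjoint ?A = U * mat_adjoint D * mat_adjoint U"
    using mat_adjoint_conj[OF Uc(2) D(1)] unfolding mat_adjoint_mat_adjoint .
  then have "mat_adjoint ?A * ?A = U * ?M * mat_adjoint U"
    using mult_conj_conj[OF unitary_mat_adjoint[OF U] mat_adjoint_carrier[OF D(1)] D(1)]
    unfolding mat_adjoint_mat_adjoint by (simp only:)
  moreover have "similar_mat (U * ?M * mat_adjoint U) ?M"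
    using Uc M by (intro similar_matI[of _ _ U "mat_adjoint U" n])
      (auto intro!: mult_carrier_mat[of _ n n _ n])
  ultimately have "char_poly (mat_adjoint ?A * ?A) = char_poly ?M"
    by (simp add: char_poly_similar)
  also have "\<dots> = (\<Prod>a\<leftarrow>diag_mat ?M. [:- a, 1:])"
    using M entry by (intro char_poly_upper_triangular[of _ n]) (auto simp: upper_triangular_def)
  finally have "proots (char_poly (mat_adjoint ?A * ?A)) = mset (diag_mat ?M)"
    by (simp add: proots_prod_list_linear)
  also have "diag_mat ?M = map (\<lambda>i. complex_of_real ((cmod (D $$ (i, i)))\<^sup>2)) [0..<n]"
    using M entry by (auto simp: diag_mat_def)
  finally show ?thesis
    by (simp add: singular_values_def multiset.map_comp o_def atLeast0LessThan)
qed

lemma schatten_norm_unitary_diagonal: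
  assumes "unitary_mat n U" "D \<in> carrier_mat n n" "diagonal_mat D"
  shows "schatten_norm p (U * D * mat_adjoint U) = lp_norm p {..<n} (\<lambda>i. cmod (D $$ (i, i)))"
  unfolding schatten_norm_def singular_values_unitary_diagonal[OF assms] lp_norm_def
  by (simp add: multiset.map_comp o_def sum_unfold_sum_mset)

text \<open>The squared moduli of the entries of a unitary matrix form a doubly stochastic matrix, which
  maps the moduli of the eigenvalues to a bound for the moduli of the diagonal entries.\<close>

lemma lp_norm_diagonal_le_schatten_norm:
  fixes A :: "complex mat"
  assumes p: "1 \<le> p" and n: "n \<noteq> 0"
    and A: "A \<in> carrier_mat n n" "mat_adjoint A * A = A * mat_adjoint A" and V: "unitary_mat n V"
  shows "lp_norm p {..<n} (\<lambda>i. cmod ((mat_adjoint V * A * V) $$ (i, i))) \<le> schatten_norm p A"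
proof -
  obtain U D where U: "unitary_mat n U" and D: "D \<in> carrier_mat n n" "diagonal_mat D"
    and AD: "A = U * D * mat_adjoint U"
    using normal_mat_unitarily_diagonalizable[OF A] .
  \<comment> \<open>The change of basis from the eigenbasis \<open>U\<close> to \<open>V\<close>:
    the diagonal entry \<open>i\<close> of the conjugated matrix is the average of the eigenvalues
    \<open>D $$ (j, j)\<close> with weights \<open>(cmod (W $$ (i, j)))\<^sup>2\<close>.\<close>
  define W where "W = mat_adjoint V * U"
  have W: "unitary_mat n W"
    unfolding W_def using U V by (intro unitary_mat_mult unitary_mat_adjoint)
  then have Wc: "W \<in> carrier_mat n n" "mat_adjoint W \<in> carrier_mat n n"
    and WW: "mat_adjoint W * W = 1\<^sub>m n" "W * mat_adjoint W = 1\<^sub>m n"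
    by (auto simp: unitary_mat_def)
  have UV: "U \<in> carrier_mat n n" "V \<in> carrier_mat n n"
    "mat_adjoint U \<in> carrier_mat n n" "mat_adjoint V \<in> carrier_mat n n"
    using U V by (auto simp: unitary_mat_def)
  have "mat_adjoint V * A * V = W * D * mat_adjoint W"
    using UV D(1)
    by (simp add: AD W_def mat_adjoint_mult[of _ n n _ n] assoc_mult_mat[of _ n n _ n _ n]
        mult_carrier_mat[of _ n n _ n])
  moreover have "(W * D * mat_adjoint W) $$ (i, i)
      = (\<Sum>j<n. W $$ (i, j) * D $$ (j, j) * cnj (W $$ (i, j)))" if i: "i < n" for i
  proof -
    have "(W * D) $$ (i, j) = W $$ (i, j) * D $$ (j, j)" if j: "j < n" for j
    proof -
      have "(W * D) $$ (i, j) = (\<Sum>k<n. if k = j then W $$ (i, j) * D $$ (j, j) else 0)"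
        unfolding index_mat_mult_sum[OF Wc(1) D(1) i j]
        using D i j by (intro sum.cong) (auto simp: diagonal_mat_def)
      then show ?thesis
        using j by simp
    qed
    then show ?thesis
      using Wc D i index_mat_mult_sum[of "W * D" n n "mat_adjoint W" n i i]
      by (simp add: mult_carrier_mat[of _ n n _ n] del: index_mult_mat)
  qed
  ultimately have "cmod ((mat_adjoint V * A * V) $$ (i, i))
      \<le> (\<Sum>j<n. (cmod (W $$ (i, j)))\<^sup>2 * cmod (D $$ (j, j)))" if "i < n" for i
    using that by (auto intro!: order_trans[OF norm_sum] sum_mono
        simp: norm_mult power2_eq_square mult_ac)
  then have "lp_norm p {..<n} (\<lambda>i. cmod ((mat_adjoint V * A * V) $$ (i, i)))
      \<le> lp_norm p {..<n} (\<lambda>i. \<Sum>j<n. (cmod (W $$ (i, j)))\<^sup>2 * cmod (D $$ (j, j)))"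
    using p n by (intro lp_norm_mono) auto
  also have "\<dots> \<le> lp_norm p {..<n} (\<lambda>j. cmod (D $$ (j, j)))"
  proof (rule lp_norm_doubly_stochastic[OF p])
    fix i assume "i \<in> {..<n}"
    then have i: "i < n" by simp
    \<comment> \<open>Row sums of the weights are diagonal entries of
      \<open>W * mat_adjoint W\<close>, column sums those of
      \<open>mat_adjoint W * W\<close>.\<close>
    have "complex_of_real (\<Sum>j<n. (cmod (W $$ (i, j)))\<^sup>2) = (W * mat_adjoint W) $$ (i, i)"
      unfolding index_mat_mult_sum[OF Wc i i]
      using Wc i by (simp add: complex_norm_square del: of_real_power)
    then show "(\<Sum>j<n. (cmod (W $$ (i, j)))\<^sup>2) = 1"
      using i by (simp add: WW del: of_real_sum)
    have "complex_of_real (\<Sum>j<n. (cmod (W $$ (j, i)))\<^sup>2) = (mat_adjoint W * W) $$ (i, i)"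
      unfolding index_mat_mult_sum[OF Wc(2,1) i i]
      using Wc i by (simp add: complex_norm_square mult.commute del: of_real_power)
    then show "(\<Sum>j<n. (cmod (W $$ (j, i)))\<^sup>2) = 1"
      using i by (simp add: WW del: of_real_sum)
  qed (use n in auto)
  also have "\<dots> = schatten_norm p A"
    unfolding AD using schatten_norm_unitary_diagonal[OF U D] by simp
  finally show ?thesis .
qed

text \<open>Normality does not pass to sums, so it is assumed of \<open>A + B\<close> separately; it
  supplies the basis in which the three diagonals are compared. The condition
  \<open>n \<noteq> 0\<close> keeps \<open>Max\<close> away from the empty set.\<close>

lemma schatten_norm_triangle_normal:
  fixes A B :: "complex mat"
  assumes p: "1 \<le> p" and n: "n \<noteq> 0"
    and A: "A \<in> carrier_mat n n" "mat_adjoint A * A = A * mat_adjoint A"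
    and B: "B \<in> carrier_mat n n" "mat_adjoint B * B = B * mat_adjoint B"
    and AB: "mat_adjoint (A + B) * (A + B) = (A + B) * mat_adjoint (A + B)"
  shows "schatten_norm p (A + B) \<le> schatten_norm p A + schatten_norm p B"
proof -
  obtain U D where U: "unitary_mat n U" and D: "D \<in> carrier_mat n n" "diagonal_mat D"
    and UD: "A + B = U * D * mat_adjoint U"
    using normal_mat_unitarily_diagonalizable[OF add_carrier_mat[OF B(1)] AB] .
  have Uc: "U \<in> carrier_mat n n" "mat_adjoint U \<in> carrier_mat n n"
    using U by (auto simp: unitary_mat_def)
  have car: "mat_adjoint U * A \<in> carrier_mat n n" "mat_adjoint U * B \<in> carrier_mat n n"
    "mat_adjoint U * A * U \<in> carrier_mat n n" "mat_adjoint U * B * U \<in> carrier_mat n n"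
    using Uc A B by (auto intro!: mult_carrier_mat[of _ n n _ n])
  have "D = mat_adjoint U * (A + B) * U"
    unfolding UD using unitary_mat_cancel[OF U D(1)] by simp
  also have "\<dots> = mat_adjoint U * A * U + mat_adjoint U * B * U"
    using Uc A B car by (simp add: mult_add_distrib_mat[of _ n n _ n] add_mult_distrib_mat[of _ n n _ _ n])
  finally have DAB: "D $$ (i, i) = (mat_adjoint U * A * U) $$ (i, i) + (mat_adjoint U * B * U) $$ (i, i)"
    if "i < n" for i
    using that car by (simp del: index_mult_mat)
  have "schatten_norm p (A + B) = lp_norm p {..<n} (\<lambda>i. cmod (D $$ (i, i)))"
    unfolding UD by (rule schatten_norm_unitary_diagonal[OF U D])
  also have "\<dots> \<le> lp_norm p {..<n} (\<lambda>i. cmod ((mat_adjoint U * A * U) $$ (i, i))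
      + cmod ((mat_adjoint U * B * U) $$ (i, i)))"
    using p n by (intro lp_norm_mono) (auto simp: DAB norm_triangle_ineq simp del: index_mult_mat)
  also have "\<dots> \<le> lp_norm p {..<n} (\<lambda>i. cmod ((mat_adjoint U * A * U) $$ (i, i)))
      + lp_norm p {..<n} (\<lambda>i. cmod ((mat_adjoint U * B * U) $$ (i, i)))"
    using p n by (intro lp_norm_triangle) auto
  also have "\<dots> \<le> schatten_norm p A + schatten_norm p B"
    using p n A B U by (intro add_mono lp_norm_diagonal_le_schatten_norm)
  finally show ?thesis .
qed

text \<open>An eigenbasis of \<open>A\<close> also diagonalizes \<open>c \<cdot>\<^sub>m A\<close>.
  Besides probabilities, the scalars 0 and -1 are used later, for the zero matrix and for swapped
  commutators.\<close>

lemma schatten_norm_smult_normal: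
  fixes A :: "complex mat"
  assumes p: "1 \<le> p" and n: "n \<noteq> 0"
    and A: "A \<in> carrier_mat n n" "mat_adjoint A * A = A * mat_adjoint A"
  shows "schatten_norm p (c \<cdot>\<^sub>m A) = cmod c * schatten_norm p A"
proof -
  obtain U D where U: "unitary_mat n U" and D: "D \<in> carrier_mat n n" "diagonal_mat D"
    and AD: "A = U * D * mat_adjoint U"
    using normal_mat_unitarily_diagonalizable[OF A] .
  have Uc: "U \<in> carrier_mat n n" "mat_adjoint U \<in> carrier_mat n n"
    using U by (auto simp: unitary_mat_def)
  have UDc: "U * D \<in> carrier_mat n n"
    using Uc D by (auto intro: mult_carrier_mat)
  have "c \<cdot>\<^sub>m A = U * (c \<cdot>\<^sub>m D) * mat_adjoint U"
    unfolding AD using mult_smult_distrib[OF Uc(1) D(1), of c] mult_smult_assoc_mat[OF UDc Uc(2), of c]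
    by simp
  moreover have "diagonal_mat (c \<cdot>\<^sub>m D)"
    using D by (auto simp: diagonal_mat_def)
  ultimately have "schatten_norm p (c \<cdot>\<^sub>m A) = lp_norm p {..<n} (\<lambda>i. cmod ((c \<cdot>\<^sub>m D) $$ (i, i)))"
    using schatten_norm_unitary_diagonal[OF U, of "c \<cdot>\<^sub>m D"] D by simp
  also have "\<dots> = lp_norm p {..<n} (\<lambda>i. cmod c * cmod (D $$ (i, i)))"
    using D by (intro lp_norm_cong) (auto simp: norm_mult)
  also have "\<dots> = cmod c * lp_norm p {..<n} (\<lambda>i. cmod (D $$ (i, i)))"
    using p n by (intro lp_norm_scale) auto
  also have "\<dots> = cmod c * schatten_norm p A"
    unfolding AD using schatten_norm_unitary_diagonal[OF U D] by simp
  finally show ?thesis .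
qed

section \<open>Measurements and post-processing\<close>

text \<open>Unlike normality, this property survives sums and real multiples, so it guarantees
  normality of all the combinations of commutators that occur.\<close>

definition skew_hermitian :: "nat \<Rightarrow> complex mat \<Rightarrow> bool" where
  "skew_hermitian n A \<longleftrightarrow> A \<in> carrier_mat n n \<and> mat_adjoint A = - A"

lemma skew_hermitian_normal:
  assumes "skew_hermitian n A"
  shows "mat_adjoint A * A = A * mat_adjoint A"
  using assms uminus_mult_left_mat[of A A] uminus_mult_right_mat[of A A]
  by (auto simp: skew_hermitian_def)

lemma skew_hermitian_zero: "skew_hermitian n (0\<^sub>m n n)"
  unfolding skew_hermitian_def by (intro conjI eq_matI) auto

lemma skew_hermitian_add:
  assumes "skew_hermitian n A" "skew_hermitian n B"
  shows "skew_hermitian n (A + B)"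
proof -
  have AB: "A \<in> carrier_mat n n" "B \<in> carrier_mat n n" and adj: "mat_adjoint A = - A" "mat_adjoint B = - B"
    using assms by (auto simp: skew_hermitian_def)
  have "mat_adjoint (A + B) = mat_adjoint A + mat_adjoint B"
    by (rule eq_matI) (use AB in \<open>auto simp: conjugate_dist_add\<close>)
  also have "\<dots> = - (A + B)"
    unfolding adj by (rule eq_matI) (use AB in auto)
  finally show ?thesis
    using AB by (simp add: skew_hermitian_def)
qed

lemma skew_hermitian_smult_real:
  assumes "skew_hermitian n A"
  shows "skew_hermitian n (complex_of_real r \<cdot>\<^sub>m A)"
proof -
  have A: "A \<in> carrier_mat n n" and adj: "mat_adjoint A = - A"
    using assms by (auto simp: skew_hermitian_def)
  have "mat_adjoint (complex_of_real r \<cdot>\<^sub>m A) = complex_of_real r \<cdot>\<^sub>m mat_adjoint A"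
    by (rule eq_matI) (use A in auto)
  also have "\<dots> = - (complex_of_real r \<cdot>\<^sub>m A)"
    unfolding adj by (rule eq_matI) (use A in auto)
  finally show ?thesis
    using A by (simp add: skew_hermitian_def)
qed

definition hermitian :: "nat \<Rightarrow> complex mat \<Rightarrow> bool" where
  "hermitian n A \<longleftrightarrow> A \<in> carrier_mat n n \<and> mat_adjoint A = A"

text \<open>The adjoint reverses products and thereby exchanges the two terms of the
  commutator.\<close>

lemma skew_hermitian_commutator:
  assumes "hermitian n A" "hermitian n B"
  shows "skew_hermitian n (commutator A B)"
proof -
  have AB: "A \<in> carrier_mat n n" "B \<in> carrier_mat n n" and adj: "mat_adjoint A = A" "mat_adjoint B = B"
    using assms by (auto simp: hermitian_def)
  have "mat_adjoint (A * B - B * A) = mat_adjoint (A * B) - mat_adjoint (B * A)"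
    by (rule eq_matI) (use AB in \<open>auto simp del: index_mult_mat(1)\<close>)
  also have "\<dots> = B * A - A * B"
    using AB by (simp add: mat_adjoint_mult[of _ n n _ n] adj)
  also have "\<dots> = - (A * B - B * A)"
    by (rule eq_matI) (use AB in \<open>auto simp del: index_mult_mat(1)\<close>)
  finally show ?thesis
    using AB by (auto simp: skew_hermitian_def commutator_def intro!: minus_carrier_mat mult_carrier_mat[of _ n n _ n])
qed

text \<open>The quadratic form is evaluated at \<open>e\<^sub>i + z e\<^sub>j\<close> with \<open>z\<close> in \<open>{0, 1, \<i>}\<close>.\<close>

lemma psd_hermitian:
  assumes "psd n A"
  shows "hermitian n A"
proof -
  have A: "A \<in> carrier_mat n n"
    using assms by (simp add: psd_def)
  have form: "Im (A $$ (i, i) + z * A $$ (i, j) + cnj z * (A $$ (j, i) + z * A $$ (j, j))) = 0"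
    if ij: "i < n" "j < n" for i j z
  proof -
    \<comment> \<open>Adding two indicators, instead of distinguishing cases, covers
      \<open>i = j\<close> as well.\<close>
    define v where "v = vec n (\<lambda>k. (if k = i then 1 else 0) + (if k = j then z else 0))"
    have v: "v \<in> carrier_vec n"
      by (simp add: v_def)
    have Av: "(A *\<^sub>v v) $ k = A $$ (k, i) + z * A $$ (k, j)" if "k < n" for k
    proof -
      have "(A *\<^sub>v v) $ k = (\<Sum>l<n. A $$ (k, l) * v $ l)"
        using A v that by (simp add: scalar_prod_def atLeast0LessThan)
      also have "\<dots> = (\<Sum>l<n. (if l = i then A $$ (k, i) else 0) + (if l = j then z * A $$ (k, j) else 0))"
        by (intro sum.cong) (auto simp: v_def algebra_simps)
      also have "\<dots> = A $$ (k, i) + z * A $$ (k, j)"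
        using ij by (simp add: sum.distrib)
      finally show ?thesis .
    qed
    have "(A *\<^sub>v v) \<bullet>c v = (\<Sum>k<n. (A *\<^sub>v v) $ k * cnj (v $ k))"
      using A v by (simp add: scalar_prod_def atLeast0LessThan)
    also have "\<dots> = (\<Sum>k<n. (if k = i then (A *\<^sub>v v) $ i else 0)
        + (if k = j then cnj z * (A *\<^sub>v v) $ j else 0))"
      by (intro sum.cong) (auto simp: v_def algebra_simps)
    also have "\<dots> = (A *\<^sub>v v) $ i + cnj z * (A *\<^sub>v v) $ j"
      using ij by (simp add: sum.distrib)
    finally have "(A *\<^sub>v v) \<bullet>c v
        = A $$ (i, i) + z * A $$ (i, j) + cnj z * (A $$ (j, i) + z * A $$ (j, j))"
      using Av ij by simp
    moreover have "0 \<le> (A *\<^sub>v v) \<bullet>c v"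
      using assms v by (simp add: psd_def)
    ultimately show ?thesis
      by (simp add: less_eq_complex_def)
  qed
  \<comment> \<open>The value \<open>z = 0\<close> makes the diagonal entries real. Then
    \<open>z = 1\<close> gives opposite imaginary parts of the two off-diagonal entries, and
    \<open>z = \<i>\<close> gives equal real parts.\<close>
  have "cnj (A $$ (j, i)) = A $$ (i, j)" if ij: "i < n" "j < n" for i j
    using form[OF ij, of 0] form[OF ij(2,1), of 0] form[OF ij, of 1] form[OF ij, of \<i>]
    by (auto simp: complex_eq_iff algebra_simps)
  then have "mat_adjoint A = A"
    by (intro eq_matI) (use A in auto)
  then show ?thesis
    using A by (simp add: hermitian_def)
qed

section \<open>Finite sums of matrices\<close>

lemma mat_sum_empty [simp]: "mat_sum d f {} = 0\<^sub>m d d"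
proof -
  interpret abelian_group "module_mat TYPE(complex) d d"
    by (rule abelian_group_mat)
  show ?thesis
    by (simp add: mat_sum_def module_mat_simps)
qed

lemma mat_sum_closed:
  assumes "\<And>a. a \<in> S \<Longrightarrow> f a \<in> carrier_mat d d"
  shows "mat_sum d f S \<in> carrier_mat d d"
proof -
  interpret abelian_group "module_mat TYPE(complex) d d"
    by (rule abelian_group_mat)
  show ?thesis
    using finsum_closed[of f S] assms by (auto simp: mat_sum_def module_mat_simps)
qed

lemma mat_sum_insert:
  assumes "finite S" "a \<notin> S" "f a \<in> carrier_mat d d" "\<And>a. a \<in> S \<Longrightarrow> f a \<in> carrier_mat d d"
  shows "mat_sum d f (insert a S) = f a + mat_sum d f S"
proof -
  interpret abelian_group "module_mat TYPE(complex) d d"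
    by (rule abelian_group_mat)
  show ?thesis
    using finsum_insert[of S a f] assms by (auto simp: mat_sum_def module_mat_simps)
qed

lemma skew_hermitian_mat_sum:
  assumes "finite S" "\<And>a. a \<in> S \<Longrightarrow> skew_hermitian d (f a)"
  shows "skew_hermitian d (mat_sum d f S)"
  using assms
proof (induction S)
  case (insert a S)
  then have "mat_sum d f (insert a S) = f a + mat_sum d f S"
    by (intro mat_sum_insert) (auto simp: skew_hermitian_def)
  with insert show ?case
    by (simp add: skew_hermitian_add)
qed (simp add: skew_hermitian_zero)

text \<open>All partial sums are again skew-Hermitian, hence normal, so the triangle inequality
  applies at each step of the induction.\<close>

lemma schatten_norm_mat_sum_le:
  assumes p: "1 \<le> p" and d: "d \<noteq> 0" and "finite S" "\<And>a. a \<in> S \<Longrightarrow> skew_hermitian d (f a)"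
  shows "schatten_norm p (mat_sum d f S) \<le> (\<Sum>a\<in>S. schatten_norm p (f a))"
  using assms(3,4)
proof (induction S)
  case empty
  \<comment> \<open>Homogeneity with scalar 0 then shows that the zero matrix has norm 0.\<close>
  have "0\<^sub>m d d = (0 :: complex) \<cdot>\<^sub>m 0\<^sub>m d d"
    by (rule eq_matI) auto
  then have "schatten_norm p (0\<^sub>m d d) = cmod 0 * schatten_norm p (0\<^sub>m d d)"
    using schatten_norm_smult_normal[OF p d zero_carrier_mat skew_hermitian_normal[OF skew_hermitian_zero], of 0]
    by (simp only:)
  then show ?case
    by simp
next
  case (insert a S)
  let ?B = "mat_sum d f S"
  have sk: "skew_hermitian d (f a)" "skew_hermitian d ?B"
    using insert by (auto intro: skew_hermitian_mat_sum)
  have "mat_sum d f (insert a S) = f a + ?B"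
    using insert by (intro mat_sum_insert) (auto simp: skew_hermitian_def)
  also have "schatten_norm p \<dots> \<le> schatten_norm p (f a) + schatten_norm p ?B"
    using sk skew_hermitian_add[OF sk]
    by (intro schatten_norm_triangle_normal[OF p d] skew_hermitian_normal) (auto simp: skew_hermitian_def)
  finally show ?case
    using insert by auto
qed

section \<open>Commutators and their behaviour under post-processing\<close>

lemma commutator_carrier:
  "A \<in> carrier_mat d d \<Longrightarrow> B \<in> carrier_mat d d \<Longrightarrow> commutator A B \<in> carrier_mat d d"
  by (auto simp: commutator_def intro!: minus_carrier_mat mult_carrier_mat[of _ d d _ d])

lemma commutator_add_left:
  assumes "A \<in> carrier_mat d d" "A' \<in> carrier_mat d d" "B \<in> carrier_mat d d"
  shows "commutator (A + A') B = commutator A B + commutator A' B"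
  unfolding commutator_def
  by (rule eq_matI) (use assms in \<open>auto simp: add_mult_distrib_mat[of _ d d] mult_add_distrib_mat[of _ d d _ d]
    simp del: index_mult_mat(1)\<close>)

lemma commutator_smult_left:
  assumes "A \<in> carrier_mat d d" "B \<in> carrier_mat d d"
  shows "commutator (c \<cdot>\<^sub>m A) B = c \<cdot>\<^sub>m commutator A B"
  unfolding commutator_def
  by (rule eq_matI) (use assms in \<open>auto simp: mult_smult_distrib[of _ d d _ d] mult_smult_assoc_mat[of _ d d _ d]
    algebra_simps simp del: index_mult_mat(1)\<close>)

lemma commutator_mat_sum_left:
  assumes "finite S" "\<And>a. a \<in> S \<Longrightarrow> E a \<in> carrier_mat d d" "B \<in> carrier_mat d d"
  shows "commutator (mat_sum d E S) B = mat_sum d (\<lambda>a. commutator (E a) B) S"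
  using assms
proof (induction S)
  case empty
  then show ?case
    by (simp add: commutator_def)
next
  case (insert a S)
  then show ?case
    by (simp add: mat_sum_insert mat_sum_closed commutator_add_left[of _ d] commutator_carrier)
qed

text \<open>The two commutators differ by the factor -1, which has modulus 1.\<close>

lemma schatten_norm_commutator_swap:
  assumes p: "1 \<le> p" and d: "d \<noteq> 0" and A: "hermitian d A" and B: "hermitian d B"
  shows "schatten_norm p (commutator A B) = schatten_norm p (commutator B A)"
proof -
  have AB: "A \<in> carrier_mat d d" "B \<in> carrier_mat d d"
    using A B by (auto simp: hermitian_def)
  have "commutator A B = (- 1) \<cdot>\<^sub>m commutator B A"
    unfolding commutator_def by (rule eq_matI) (use AB in \<open>auto simp del: index_mult_mat(1)\<close>)
  then show ?thesis
    using schatten_norm_smult_normal[OF p d commutator_carrier[OF AB(2,1)]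
        skew_hermitian_normal[OF skew_hermitian_commutator[OF B A]], of "- 1"] by simp
qed

lemma Upsilon_swap:
  assumes "1 \<le> p" "d \<noteq> 0" "\<And>a. a \<in> {1..n} \<Longrightarrow> hermitian d (E a)" "\<And>b. b \<in> {1..m} \<Longrightarrow> hermitian d (F b)"
  shows "Upsilon p n E m F = Upsilon p m F n E"
  unfolding Upsilon_def using assms
  by (subst sum.swap) (auto intro!: sum.cong schatten_norm_commutator_swap)

text \<open>Linearity of the commutator in its first argument and the triangle inequality bound each
  new term by old norms weighted with \<open>P a' a\<close>; over all \<open>a'\<close> the weights
  of each old norm add up to 1.\<close>

lemma Upsilon_post_processing_left:
  assumes p: "1 \<le> p" and d: "d \<noteq> 0"
    and E: "\<And>a. a \<in> {1..n} \<Longrightarrow> hermitian d (E a)" and F: "\<And>b. b \<in> {1..m} \<Longrightarrow> hermitian d (F b)"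
    and post: "post_processing d n E n' E'"
  shows "Upsilon p n' E' m F \<le> Upsilon p n E m F"
proof -
  obtain P :: "nat \<Rightarrow> nat \<Rightarrow> real"
    where P0: "\<And>a' a. a' \<in> {1..n'} \<Longrightarrow> a \<in> {1..n} \<Longrightarrow> 0 \<le> P a' a"
      and P1: "\<And>a. a \<in> {1..n} \<Longrightarrow> (\<Sum>a' = 1..n'. P a' a) = 1"
      and E': "\<And>a'. a' \<in> {1..n'} \<Longrightarrow>
        E' a' = mat_sum d (\<lambda>a. complex_of_real (P a' a) \<cdot>\<^sub>m E a) {1..n}"
    using post unfolding post_processing_def by blast
  let ?N = "\<lambda>a b. schatten_norm p (commutator (E a) (F b))"
  have "schatten_norm p (commutator (E' a') (F b)) \<le> (\<Sum>a = 1..n. P a' a * ?N a b)"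
    if a': "a' \<in> {1..n'}" and b: "b \<in> {1..m}" for a' b
  proof -
    let ?C = "\<lambda>a. complex_of_real (P a' a) \<cdot>\<^sub>m commutator (E a) (F b)"
    have Ec: "E a \<in> carrier_mat d d" if "a \<in> {1..n}" for a
      using E[OF that] by (simp add: hermitian_def)
    have Fc: "F b \<in> carrier_mat d d"
      using F[OF b] by (simp add: hermitian_def)
    have sk: "skew_hermitian d (commutator (E a) (F b))" if "a \<in> {1..n}" for a
      using E[OF that] F[OF b] by (rule skew_hermitian_commutator)
    have "commutator (E' a') (F b)
        = mat_sum d (\<lambda>a. commutator (complex_of_real (P a' a) \<cdot>\<^sub>m E a) (F b)) {1..n}"
      unfolding E'[OF a'] using Ec Fc by (intro commutator_mat_sum_left) auto
    then have "schatten_norm p (commutator (E' a') (F b))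
        \<le> (\<Sum>a = 1..n. schatten_norm p (commutator (complex_of_real (P a' a) \<cdot>\<^sub>m E a) (F b)))"
      using Ec Fc sk
      by (simp only:, intro schatten_norm_mat_sum_le[OF p d])
        (auto simp: commutator_smult_left[of _ d] skew_hermitian_smult_real)
    also have "\<dots> = (\<Sum>a = 1..n. P a' a * ?N a b)"
      using Ec Fc P0[OF a']
      by (intro sum.cong refl)
        (simp add: commutator_smult_left[of _ d] commutator_carrier
          schatten_norm_smult_normal[OF p d _ skew_hermitian_normal[OF sk]])
    finally show ?thesis .
  qed
  then have "Upsilon p n' E' m F \<le> (\<Sum>a' = 1..n'. \<Sum>b = 1..m. \<Sum>a = 1..n. P a' a * ?N a b)"
    unfolding Upsilon_def by (intro sum_mono)
  \<comment> \<open>The sum over the new outcomes moves innermost, where the norm is a constant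
    factor.\<close>
  also have "\<dots> = (\<Sum>b = 1..m. \<Sum>a = 1..n. \<Sum>a' = 1..n'. P a' a * ?N a b)"
    by (subst sum.swap) (intro sum.cong refl sum.swap)
  also have "\<dots> = (\<Sum>b = 1..m. \<Sum>a = 1..n. ?N a b)"
    using P1 by (intro sum.cong refl) (simp flip: sum_distrib_right)
  also have "\<dots> = Upsilon p n E m F"
    unfolding Upsilon_def by (rule sum.swap)
  finally show ?thesis .
qed

lemma measurement_hermitian: "measurement d n E \<Longrightarrow> a \<in> {1..n} \<Longrightarrow> hermitian d (E a)"
  by (simp add: measurement_def psd_hermitian)

text \<open>In dimension 0 the zero matrix is the only operator, while the operators of a
  measurement are non-zero. This settles the dimension excluded from the norm estimates.\<close>

lemma measurement_dim_0:
  assumes "measurement 0 n E"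
  shows "n = 0"
proof (rule ccontr)
  assume "n \<noteq> 0"
  then have "E 1 \<in> carrier_mat 0 0" "E 1 \<noteq> 0\<^sub>m 0 0"
    using assms by (auto simp: measurement_def psd_def)
  moreover have "E 1 = 0\<^sub>m 0 0"
    by (rule eq_matI) (use \<open>E 1 \<in> carrier_mat 0 0\<close> in auto)
  ultimately show False
    by simp
qed

theorem mainTheorem3:
  fixes p :: ereal and d n m :: nat and E F :: "nat \<Rightarrow> complex mat"
  assumes "1 \<le> p"
    and "measurement d n E" and "measurement d m F"
  shows "(\<forall>n' E'. measurement d n' E' \<and> post_processing d n E n' E' \<longrightarrow>
            Upsilon p n' E' m F \<le> Upsilon p n E m F) \<and>
         (\<forall>n' E' m' F'. measurement d n' E' \<and> post_processing d n E n' E' \<and>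
            measurement d m' F' \<and> post_processing d m F m' F' \<longrightarrow>
            Upsilon p n' E' m' F' \<le> Upsilon p n E m F)"
proof (cases "d = 0")
  \<comment> \<open>There are no outcomes in dimension 0, so every \<open>Upsilon\<close> in the
    claim is an empty sum.\<close>
  case True
  then have "Upsilon p k X l Y = 0" if "measurement d k X" for k l X Y
    using measurement_dim_0[of k X] that by (simp add: Upsilon_def)
  then show ?thesis
    using assms(2) by auto
next
  case d: False
  note herm = measurement_hermitian
  have left: "Upsilon p n' E' m F \<le> Upsilon p n E m F" if "post_processing d n E n' E'" for n' E'
    using assms d that by (intro Upsilon_post_processing_left[of p d]) (auto intro: herm)
  have "Upsilon p n' E' m' F' \<le> Upsilon p n E m F"
    if E': "measurement d n' E'" "post_processing d n E n' E'"
      and F': "measurement d m' F'" "post_processing d m F m' F'" for n' E' m' F'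
  proof -
    \<comment> \<open>Symmetry brings \<open>F'\<close> to the first place, where it is compared
      with \<open>F\<close> while \<open>E'\<close> stays fixed; swapping back leaves the comparison
      of \<open>E'\<close> with \<open>E\<close>.\<close>
    have "Upsilon p n' E' m' F' = Upsilon p m' F' n' E'"
      using assms d E' F' by (intro Upsilon_swap[of p d]) (auto intro: herm)
    also have "\<dots> \<le> Upsilon p m F n' E'"
      using assms d E' F' by (intro Upsilon_post_processing_left[of p d]) (auto intro: herm)
    also have "\<dots> = Upsilon p n' E' m F"
      using assms d E' by (intro Upsilon_swap[of p d]) (auto intro: herm)
    also have "\<dots> \<le> Upsilon p n E m F"
      using left E' by blast
    finally show ?thesis .
  qed
  then show ?thesis
    using left by blast
qed

end
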